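(* Let $A=(A,\cdot,\circ)$ be a skew brace with gamma function $\gamma$. Then the following are equivalent: (1) $A$ is $\gamma$-homomorphic. (2) $A^2=A*A$ is contained in $\ker(\gamma)$. (3) $A$ is right nilpotent of class at most $2$.
   Context: A skew brace (meaning skew left brace) is a set $A$ with two group structures $(A,\cdot)$ (the additive group) and $(A,\circ)$ (the multiplicative group) such that $a\circ(b\cdot c)=(a\circ b)\cdot a^{-1}\cdot(a\circ c)$ for all $a,b,c\in A$, where $a^{-1}$ is the inverse of $a$ in $(A,\cdot)$. The two groups have the same neutral element, denoted $1$. The gamma function of a skew brace $(A,\cdot,\circ)$ is the group homomorphism $\gamma\colon(A,\circ)\to\operatorname{Aut}(A,\cdot)$ given by $\gamma(a)(b)=a^{-1}\cdot(a\circ b)$, and $\ker(\gamma)=\{a\in A\mid\gamma(a)=\mathrm{id}\}$. The skew brace $A$ is $\gamma$-homomorphic if $\gamma\colon(A,\cdot)\to\operatorname{Aut}(A,\cdot)$ is also a group homomorphism. For $a,b\in A$ put $a*b=a^{-1}\cdot(a\circ b)\cdot b^{-1}$. For subsets $X,Y\subseteq A$, $X*Y$ is the subgroup of $(A,\cdot)$ generated by $\{x*y\mid x\in X,\ y\in Y\}$. Set $A^{(1)}=A$ and $A^{(m)}=A^{(m-1)}*A$ for $m\ge2$. The skew brace $A$ is right nilpotent if $A^{(m)}=\{1\}$ for some $m\ge1$; if $m$ is minimal with this property, $m-1$ is called the right nilpotency class of $A$. *)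

theory Defs
  imports "HOL-Algebra.Bij" "HOL-Algebra.Generated_Groups"
begin

text \<open>
  A skew left brace is a pair of groups \<open>G\<close> (additive, written as a dot on paper) and \<open>M\<close>
  (multiplicative, written as a circle) on one and the same carrier. That both groups
  have the same neutral element is a consequence, see \<open>one_eq\<close> below.
\<close>

locale skew_brace = additive: group G + multiplicative: group M
  for G :: "('a, 'b) monoid_scheme" (structure) and M :: "('a, 'c) monoid_scheme" (structure) +
  assumes carrier_eq: "carrier M = carrier G"
    and brace_compat:
      "\<lbrakk>a \<in> carrier G; b \<in> carrier G; c \<in> carrier G\<rbrakk> \<Longrightarrow>
        a \<otimes>\<^bsub>M\<^esub> (b \<otimes>\<^bsub>G\<^esub> c) = (a \<otimes>\<^bsub>M\<^esub> b) \<otimes>\<^bsub>G\<^esub> inv\<^bsub>G\<^esub> a \<otimes>\<^bsub>G\<^esub> (a \<otimes>\<^bsub>M\<^esub> c)"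

text \<open>
  The elements of \<^const>\<open>AutoGroup\<close> are extensional functions, hence the
  restriction to the carrier.
\<close>

definition brace_gamma ::
    "('a, 'b) monoid_scheme \<Rightarrow> ('a, 'c) monoid_scheme \<Rightarrow> 'a \<Rightarrow> 'a \<Rightarrow> 'a" where
  "brace_gamma G M a = (\<lambda>b\<in>carrier G. inv\<^bsub>G\<^esub> a \<otimes>\<^bsub>G\<^esub> (a \<otimes>\<^bsub>M\<^esub> b))"

definition gamma_homomorphic ::
    "('a, 'b) monoid_scheme \<Rightarrow> ('a, 'c) monoid_scheme \<Rightarrow> bool" where
  "gamma_homomorphic G M \<longleftrightarrow> brace_gamma G M \<in> hom G (AutoGroup G)"

definition gamma_kernel ::
    "('a, 'b) monoid_scheme \<Rightarrow> ('a, 'c) monoid_scheme \<Rightarrow> 'a set" where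
  "gamma_kernel G M = kernel M (AutoGroup G) (brace_gamma G M)"

definition brace_star ::
    "('a, 'b) monoid_scheme \<Rightarrow> ('a, 'c) monoid_scheme \<Rightarrow> 'a \<Rightarrow> 'a \<Rightarrow> 'a" where
  "brace_star G M a b = inv\<^bsub>G\<^esub> a \<otimes>\<^bsub>G\<^esub> (a \<otimes>\<^bsub>M\<^esub> b) \<otimes>\<^bsub>G\<^esub> inv\<^bsub>G\<^esub> b"

definition brace_star_set ::
    "('a, 'b) monoid_scheme \<Rightarrow> ('a, 'c) monoid_scheme \<Rightarrow> 'a set \<Rightarrow> 'a set \<Rightarrow> 'a set" where
  "brace_star_set G M X Y = generate G {brace_star G M x y | x y. x \<in> X \<and> y \<in> Y}"

text \<open>The series is indexed from 1; the value at 0 is a dummy that is never used.\<close>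

fun right_series ::
    "('a, 'b) monoid_scheme \<Rightarrow> ('a, 'c) monoid_scheme \<Rightarrow> nat \<Rightarrow> 'a set" where
  "right_series G M 0 = carrier G"
| "right_series G M (Suc 0) = carrier G"
| "right_series G M (Suc (Suc n)) = brace_star_set G M (right_series G M (Suc n)) (carrier G)"

definition right_nilpotent ::
    "('a, 'b) monoid_scheme \<Rightarrow> ('a, 'c) monoid_scheme \<Rightarrow> bool" where
  "right_nilpotent G M \<longleftrightarrow> (\<exists>m\<ge>1. right_series G M m = {\<one>\<^bsub>G\<^esub>})"

text \<open>Only meaningful when \<open>right_nilpotent G M\<close> holds.\<close>

definition right_nilpotency_class ::
    "('a, 'b) monoid_scheme \<Rightarrow> ('a, 'c) monoid_scheme \<Rightarrow> nat" where
  "right_nilpotency_class G M = (LEAST m. m \<ge> 1 \<and> right_series G M m = {\<one>\<^bsub>G\<^esub>}) - 1"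

context skew_brace
begin

lemma mult_closed [simp]:
  "\<lbrakk>a \<in> carrier G; b \<in> carrier G\<rbrakk> \<Longrightarrow> a \<otimes>\<^bsub>M\<^esub> b \<in> carrier G"
  using multiplicative.m_closed carrier_eq by auto

lemma one_eq: "\<one>\<^bsub>M\<^esub> = \<one>\<^bsub>G\<^esub>"
proof -
  have o: "\<one>\<^bsub>M\<^esub> \<in> carrier G" using multiplicative.one_closed carrier_eq by auto
  have "\<one>\<^bsub>M\<^esub> \<otimes>\<^bsub>M\<^esub> (\<one>\<^bsub>G\<^esub> \<otimes>\<^bsub>G\<^esub> \<one>\<^bsub>G\<^esub>)
      = (\<one>\<^bsub>M\<^esub> \<otimes>\<^bsub>M\<^esub> \<one>\<^bsub>G\<^esub>) \<otimes>\<^bsub>G\<^esub> inv\<^bsub>G\<^esub> \<one>\<^bsub>M\<^esub> \<otimes>\<^bsub>G\<^esub> (\<one>\<^bsub>M\<^esub> \<otimes>\<^bsub>M\<^esub> \<one>\<^bsub>G\<^esub>)"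
    using o by (intro brace_compat) auto
  then have "inv\<^bsub>G\<^esub> \<one>\<^bsub>M\<^esub> = \<one>\<^bsub>G\<^esub>" using o carrier_eq by simp
  then show ?thesis using o by (metis additive.inv_inv additive.inv_one)
qed

lemma gamma_closed: "\<lbrakk>a \<in> carrier G; b \<in> carrier G\<rbrakk> \<Longrightarrow> brace_gamma G M a b \<in> carrier G"
  by (simp add: brace_gamma_def)

lemma mult_eq_gamma:
  "\<lbrakk>a \<in> carrier G; b \<in> carrier G\<rbrakk> \<Longrightarrow> a \<otimes>\<^bsub>M\<^esub> b = a \<otimes>\<^bsub>G\<^esub> brace_gamma G M a b"
  by (simp add: brace_gamma_def additive.m_assoc [symmetric])

lemma gamma_add:
  assumes "a \<in> carrier G" "b \<in> carrier G" "c \<in> carrier G"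
  shows "brace_gamma G M a (b \<otimes>\<^bsub>G\<^esub> c) = brace_gamma G M a b \<otimes>\<^bsub>G\<^esub> brace_gamma G M a c"
  using assms by (simp add: brace_gamma_def brace_compat additive.m_assoc)

lemma gamma_mult:
  assumes a: "a \<in> carrier G" and b: "b \<in> carrier G" and c: "c \<in> carrier G"
  shows "brace_gamma G M (a \<otimes>\<^bsub>M\<^esub> b) c = brace_gamma G M a (brace_gamma G M b c)"
proof -
  have "(a \<otimes>\<^bsub>M\<^esub> b) \<otimes>\<^bsub>G\<^esub> brace_gamma G M (a \<otimes>\<^bsub>M\<^esub> b) c = a \<otimes>\<^bsub>M\<^esub> (b \<otimes>\<^bsub>M\<^esub> c)"
    using assms carrier_eq by (simp add: mult_eq_gamma [symmetric] multiplicative.m_assoc)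
  also have "\<dots> = a \<otimes>\<^bsub>G\<^esub> brace_gamma G M a (b \<otimes>\<^bsub>G\<^esub> brace_gamma G M b c)"
    using assms by (simp add: mult_eq_gamma gamma_closed)
  also have "\<dots> = (a \<otimes>\<^bsub>M\<^esub> b) \<otimes>\<^bsub>G\<^esub> brace_gamma G M a (brace_gamma G M b c)"
    using assms by (simp add: gamma_add gamma_closed mult_eq_gamma additive.m_assoc)
  finally show ?thesis using assms by (simp add: gamma_closed)
qed

lemma gamma_one: "b \<in> carrier G \<Longrightarrow> brace_gamma G M \<one>\<^bsub>M\<^esub> b = b"
  using carrier_eq multiplicative.l_one[of b] by (simp add: brace_gamma_def one_eq)

lemma gamma_in_auto:
  assumes a: "a \<in> carrier G" shows "brace_gamma G M a \<in> auto G"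
proof -
  have i: "inv\<^bsub>M\<^esub> a \<in> carrier G" using a carrier_eq multiplicative.inv_closed by auto
  have "bij_betw (brace_gamma G M a) (carrier G) (carrier G)"
  proof (rule bij_betw_byWitness[where f' = "brace_gamma G M (inv\<^bsub>M\<^esub> a)"])
    show "\<forall>x\<in>carrier G. brace_gamma G M (inv\<^bsub>M\<^esub> a) (brace_gamma G M a x) = x"
      using a i carrier_eq by (auto simp: gamma_mult [symmetric] gamma_one)
    show "\<forall>x\<in>carrier G. brace_gamma G M a (brace_gamma G M (inv\<^bsub>M\<^esub> a) x) = x"
      using a i carrier_eq by (auto simp: gamma_mult [symmetric] gamma_one)
  qed (use a i gamma_closed in auto)
  moreover have "brace_gamma G M a \<in> extensional (carrier G)"
    by (simp add: brace_gamma_def)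
  ultimately show ?thesis
    using a by (auto simp: auto_def Bij_def hom_def gamma_closed gamma_add)
qed

lemma gamma_hom: "brace_gamma G M \<in> hom M (AutoGroup G)"
proof (rule homI)
  fix a assume "a \<in> carrier M"
  then show "brace_gamma G M a \<in> carrier (AutoGroup G)"
    using gamma_in_auto carrier_eq by (simp add: AutoGroup_def)
next
  fix a b assume "a \<in> carrier M" "b \<in> carrier M"
  then have ab: "a \<in> carrier G" "b \<in> carrier G" using carrier_eq by auto
  then have "brace_gamma G M a \<in> Bij (carrier G)" "brace_gamma G M b \<in> Bij (carrier G)"
    using gamma_in_auto by (auto simp: auto_def)
  moreover have "brace_gamma G M (a \<otimes>\<^bsub>M\<^esub> b)
      = compose (carrier G) (brace_gamma G M a) (brace_gamma G M b)"
  proof (rule extensionalityI)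
    show "brace_gamma G M (a \<otimes>\<^bsub>M\<^esub> b) \<in> extensional (carrier G)"
      by (simp add: brace_gamma_def)
  qed (use ab in \<open>auto simp: gamma_mult compose_eq\<close>)
  ultimately show "brace_gamma G M (a \<otimes>\<^bsub>M\<^esub> b)
      = brace_gamma G M a \<otimes>\<^bsub>AutoGroup G\<^esub> brace_gamma G M b"
    by (simp add: AutoGroup_def BijGroup_def)
qed

lemma gamma_kernel_eq:
  "gamma_kernel G M = {a \<in> carrier G. \<forall>b\<in>carrier G. brace_gamma G M a b = b}"
proof -
  have "brace_gamma G M a = (\<lambda>x\<in>carrier G. x) \<longleftrightarrow>
      (\<forall>b\<in>carrier G. brace_gamma G M a b = b)" for a
    by (auto simp: brace_gamma_def restrict_def fun_eq_iff)
  then show ?thesis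
    by (simp add: gamma_kernel_def kernel_def carrier_eq AutoGroup_def BijGroup_def)
qed

end

end

theory Submission
  imports Defs
begin

text \<open>
  Write \<open>\<gamma>\<close> for the gamma function. Since \<open>\<gamma>\<close> is always a homomorphism on the multiplicative
  group and \<open>a \<circ> b = a \<cdot> \<gamma>(a)(b)\<close>, one has
    \<open>\<gamma>(a \<cdot> \<gamma>(a)(b)) = \<gamma>(a) \<gamma>(b)\<close>
  in every skew brace. As \<open>\<gamma>(a)\<close> is onto, every product \<open>a \<cdot> c\<close> has the form on the left, so
  \<open>A\<close> is \<open>\<gamma>\<close>-homomorphic if and only if \<open>\<gamma>(\<gamma>(a)(b)) = \<gamma>(b)\<close> for all \<open>a\<close> and \<open>b\<close>
  (\<open>gamma_homomorphic_iff_invariant\<close>). The elements \<open>\<gamma>(a)(b)\<close> and \<open>b\<close> differ additively by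
  \<open>a * b\<close>, because \<open>\<gamma>(a)(b) = (a * b) \<cdot> b\<close>. An element \<open>k\<close> of the kernel satisfies
  \<open>k \<cdot> b = k \<circ> b\<close>, hence \<open>\<gamma>(k \<cdot> b) = \<gamma>(b)\<close>; so \<open>A * A \<subseteq> ker \<gamma>\<close> gives the invariance. If, on the
  other hand, \<open>\<gamma>\<close> is additive, then invariance puts every \<open>a * b\<close> into the kernel.

  The kernel is an additive subgroup in any case, so it contains \<open>A * A\<close> as soon as it
  contains the generators \<open>a * b\<close>. Finally, \<open>x * y = 1\<close> means \<open>\<gamma>(x)(y) = y\<close>. So \<open>X * A = 1\<close> is
  the same as \<open>X \<subseteq> ker \<gamma>\<close>, and for \<open>X = A * A\<close> this says that
  \<open>A * A \<subseteq> ker \<gamma>\<close> is the same as \<open>(A * A) * A = 1\<close>. Since the series stays trivial once it is trivial, the latter is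
  right nilpotency of class at most two.
\<close>

context skew_brace
begin

lemma gamma_surj:
  assumes "a \<in> carrier G" "c \<in> carrier G"
  obtains b where "b \<in> carrier G" "brace_gamma G M a b = c"
proof -
  have "brace_gamma G M a ` carrier G = carrier G"
    using gamma_in_auto[OF assms(1)] by (auto simp: auto_def Bij_def bij_betw_def)
  then show thesis using assms(2) that by (metis imageE)
qed

lemma gamma_left_cancel:
  assumes "a \<in> carrier G" "b \<in> carrier G" "c \<in> carrier G"
    and "brace_gamma G M a b = brace_gamma G M a c"
  shows "b = c"
proof -
  have "inj_on (brace_gamma G M a) (carrier G)"
    using gamma_in_auto[OF assms(1)] by (auto simp: auto_def Bij_def bij_betw_def)
  then show ?thesis using assms by (auto dest: inj_onD)
qed

lemma star_closed:
  "\<lbrakk>a \<in> carrier G; b \<in> carrier G\<rbrakk> \<Longrightarrow> brace_star G M a b \<in> carrier G"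
  by (simp add: brace_star_def)

lemma gamma_eq_star_mult:
  "\<lbrakk>a \<in> carrier G; b \<in> carrier G\<rbrakk> \<Longrightarrow>
    brace_gamma G M a b = brace_star G M a b \<otimes>\<^bsub>G\<^esub> b"
  by (simp add: brace_star_def brace_gamma_def additive.m_assoc)

lemma star_eq_one_iff:
  assumes "a \<in> carrier G" "b \<in> carrier G"
  shows "brace_star G M a b = \<one>\<^bsub>G\<^esub> \<longleftrightarrow> brace_gamma G M a b = b"
  using assms star_closed by (simp add: gamma_eq_star_mult)

lemma star_set_subset:
  assumes "X \<subseteq> carrier G" "Y \<subseteq> carrier G"
  shows "brace_star_set G M X Y \<subseteq> carrier G"
  unfolding brace_star_set_def
  by (rule additive.generate_incl) (use assms star_closed in auto)

lemma gamma_kernel_mult_eq: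
  assumes "k \<in> gamma_kernel G M" "b \<in> carrier G"
  shows "k \<otimes>\<^bsub>G\<^esub> b = k \<otimes>\<^bsub>M\<^esub> b"
  using assms by (simp add: gamma_kernel_eq mult_eq_gamma)

lemma gamma_kernel_mult:
  assumes "k \<in> gamma_kernel G M" "b \<in> carrier G" "c \<in> carrier G"
  shows "brace_gamma G M (k \<otimes>\<^bsub>G\<^esub> b) c = brace_gamma G M b c"
proof -
  have k: "k \<in> carrier G" "brace_gamma G M k d = d" if "d \<in> carrier G" for d
    using assms(1) that by (auto simp: gamma_kernel_eq)
  show ?thesis
    using assms k by (simp add: gamma_kernel_mult_eq gamma_mult gamma_closed)
qed

text \<open>
  The kernel is a subgroup of the multiplicative group by definition. On it the two products
  agree, which makes it an additive subgroup as well.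
\<close>

lemma gamma_kernel_subgroup: "subgroup (gamma_kernel G M) G"
proof (rule additive.subgroupI)
  show "gamma_kernel G M \<subseteq> carrier G" by (auto simp: gamma_kernel_eq)
  have "\<one>\<^bsub>G\<^esub> \<in> gamma_kernel G M"
    by (auto simp: gamma_kernel_eq gamma_one one_eq [symmetric]) (simp add: one_eq)
  then show "gamma_kernel G M \<noteq> {}" by blast
next
  fix k assume k: "k \<in> gamma_kernel G M"
  then have kG: "k \<in> carrier G" by (simp add: gamma_kernel_eq)
  have "brace_gamma G M (inv\<^bsub>G\<^esub> k) c = c" if c: "c \<in> carrier G" for c
  proof -
    have "brace_gamma G M (inv\<^bsub>G\<^esub> k) c = brace_gamma G M (k \<otimes>\<^bsub>G\<^esub> inv\<^bsub>G\<^esub> k) c"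
      using k kG c by (simp only: gamma_kernel_mult additive.inv_closed)
    then show ?thesis using kG c gamma_one by (simp add: one_eq)
  qed
  then show "inv\<^bsub>G\<^esub> k \<in> gamma_kernel G M" using kG by (simp add: gamma_kernel_eq)
next
  fix k l assume kl: "k \<in> gamma_kernel G M" "l \<in> gamma_kernel G M"
  then have "brace_gamma G M (k \<otimes>\<^bsub>G\<^esub> l) c = c" if "c \<in> carrier G" for c
    using that by (simp add: gamma_kernel_eq gamma_kernel_mult)
  then show "k \<otimes>\<^bsub>G\<^esub> l \<in> gamma_kernel G M"
    using kl by (auto simp: gamma_kernel_eq)
qed

lemma star_set_subset_gamma_kernel_iff:
  assumes "X \<subseteq> carrier G" "Y \<subseteq> carrier G"
  shows "brace_star_set G M X Y \<subseteq> gamma_kernel G M \<longleftrightarrow>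
    (\<forall>x\<in>X. \<forall>y\<in>Y. brace_star G M x y \<in> gamma_kernel G M)"
proof
  assume "brace_star_set G M X Y \<subseteq> gamma_kernel G M"
  then show "\<forall>x\<in>X. \<forall>y\<in>Y. brace_star G M x y \<in> gamma_kernel G M"
    unfolding brace_star_set_def by (blast intro: generate.incl)
next
  assume "\<forall>x\<in>X. \<forall>y\<in>Y. brace_star G M x y \<in> gamma_kernel G M"
  then show "brace_star_set G M X Y \<subseteq> gamma_kernel G M"
    unfolding brace_star_set_def
    by (intro additive.generate_subgroup_incl gamma_kernel_subgroup) blast
qed

text \<open>
  This passes from the product of extensional functions in the automorphism group to values
  on the carrier.
\<close>

lemma gamma_homomorphic_iff:
  "gamma_homomorphic G M \<longleftrightarrow>
    (\<forall>a\<in>carrier G. \<forall>b\<in>carrier G. \<forall>c\<in>carrier G.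
      brace_gamma G M (a \<otimes>\<^bsub>G\<^esub> b) c = brace_gamma G M a (brace_gamma G M b c))"
proof -
  have prod: "brace_gamma G M a \<otimes>\<^bsub>AutoGroup G\<^esub> brace_gamma G M b
      = compose (carrier G) (brace_gamma G M a) (brace_gamma G M b)"
    if "a \<in> carrier G" "b \<in> carrier G" for a b
    using that gamma_in_auto by (simp add: AutoGroup_def BijGroup_def auto_def)
  have ext: "brace_gamma G M d = compose (carrier G) (brace_gamma G M a) (brace_gamma G M b) \<longleftrightarrow>
      (\<forall>c\<in>carrier G. brace_gamma G M d c = brace_gamma G M a (brace_gamma G M b c))" for a b d
    by (auto simp: brace_gamma_def compose_def restrict_def fun_eq_iff)
  have "brace_gamma G M \<in> carrier G \<rightarrow> carrier (AutoGroup G)"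
    using gamma_in_auto by (auto simp: AutoGroup_def)
  then show ?thesis
    by (simp add: gamma_homomorphic_def hom_def prod ext)
qed

lemma gamma_homomorphic_iff_invariant:
  "gamma_homomorphic G M \<longleftrightarrow>
    (\<forall>a\<in>carrier G. \<forall>b\<in>carrier G. \<forall>c\<in>carrier G.
      brace_gamma G M (brace_gamma G M a b) c = brace_gamma G M b c)"
    (is "_ \<longleftrightarrow> ?inv")
proof
  assume hom: "gamma_homomorphic G M"
  show ?inv
  proof (intro ballI)
    fix a b c assume abc: "a \<in> carrier G" "b \<in> carrier G" "c \<in> carrier G"
    have "brace_gamma G M a (brace_gamma G M (brace_gamma G M a b) c)
        = brace_gamma G M (a \<otimes>\<^bsub>G\<^esub> brace_gamma G M a b) c"
      using hom abc by (simp add: gamma_homomorphic_iff gamma_closed)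
    also have "\<dots> = brace_gamma G M a (brace_gamma G M b c)"
      using abc by (simp add: mult_eq_gamma [symmetric] gamma_mult)
    finally show "brace_gamma G M (brace_gamma G M a b) c = brace_gamma G M b c"
      using abc gamma_left_cancel gamma_closed by meson
  qed
next
  assume inv: ?inv
  show "gamma_homomorphic G M"
    unfolding gamma_homomorphic_iff
  proof (intro ballI)
    fix a b c assume abc: "a \<in> carrier G" "b \<in> carrier G" "c \<in> carrier G"
    obtain d where d: "d \<in> carrier G" "brace_gamma G M a d = b"
      using gamma_surj abc by blast
    have "brace_gamma G M (a \<otimes>\<^bsub>G\<^esub> b) c = brace_gamma G M a (brace_gamma G M d c)"
      using abc d by (simp add: gamma_mult [symmetric] mult_eq_gamma)
    also have "brace_gamma G M d c = brace_gamma G M b c"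
      using inv abc d by metis
    finally show "brace_gamma G M (a \<otimes>\<^bsub>G\<^esub> b) c = brace_gamma G M a (brace_gamma G M b c)" .
  qed
qed

lemma gamma_homomorphic_iff_star_subset_kernel:
  "gamma_homomorphic G M \<longleftrightarrow>
    brace_star_set G M (carrier G) (carrier G) \<subseteq> gamma_kernel G M"
proof
  assume hom: "gamma_homomorphic G M"
  have "brace_gamma G M (brace_star G M a b) c = c"
    if abc: "a \<in> carrier G" "b \<in> carrier G" "c \<in> carrier G" for a b c
  proof -
    \<comment> \<open>Additivity splits off the right factor of \<open>(a * b) \<cdot> b\<close>, and invariance cancels it; this
      gives the claim on the image of \<open>\<gamma>(b)\<close>, hence everywhere.\<close>
    obtain d where d: "d \<in> carrier G" "brace_gamma G M b d = c"
      using gamma_surj abc by blast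
    have "brace_gamma G M (brace_star G M a b) (brace_gamma G M b d)
        = brace_gamma G M (brace_gamma G M a b) d"
      using hom abc d by (simp add: gamma_homomorphic_iff star_closed gamma_eq_star_mult)
    also have "\<dots> = brace_gamma G M b d"
      using hom abc d by (simp add: gamma_homomorphic_iff_invariant)
    finally show ?thesis using d by simp
  qed
  then have "brace_star G M a b \<in> gamma_kernel G M"
    if "a \<in> carrier G" "b \<in> carrier G" for a b
    using that by (simp add: gamma_kernel_eq star_closed)
  then show "brace_star_set G M (carrier G) (carrier G) \<subseteq> gamma_kernel G M"
    by (simp add: star_set_subset_gamma_kernel_iff)
next
  assume "brace_star_set G M (carrier G) (carrier G) \<subseteq> gamma_kernel G M"
  then have "brace_star G M a b \<in> gamma_kernel G M"
    if "a \<in> carrier G" "b \<in> carrier G" for a b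
    using that by (simp add: star_set_subset_gamma_kernel_iff)
  then show "gamma_homomorphic G M"
    by (simp add: gamma_homomorphic_iff_invariant gamma_eq_star_mult gamma_kernel_mult)
qed

lemma star_set_carrier_trivial_iff:
  assumes X: "X \<subseteq> carrier G"
  shows "brace_star_set G M X (carrier G) = {\<one>\<^bsub>G\<^esub>} \<longleftrightarrow> X \<subseteq> gamma_kernel G M"
proof
  assume triv: "brace_star_set G M X (carrier G) = {\<one>\<^bsub>G\<^esub>}"
  have "brace_star G M x y = \<one>\<^bsub>G\<^esub>" if "x \<in> X" "y \<in> carrier G" for x y
  proof -
    have "brace_star G M x y \<in> brace_star_set G M X (carrier G)"
      using that unfolding brace_star_set_def by (blast intro: generate.incl)
    then show ?thesis using triv by simp
  qed
  then show "X \<subseteq> gamma_kernel G M"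
    using X by (auto simp: gamma_kernel_eq subset_iff star_eq_one_iff [symmetric])
next
  assume "X \<subseteq> gamma_kernel G M"
  then have "brace_star G M x y = \<one>\<^bsub>G\<^esub>" if "x \<in> X" "y \<in> carrier G" for x y
    using that X star_eq_one_iff by (auto simp: gamma_kernel_eq)
  then have "{brace_star G M x y | x y. x \<in> X \<and> y \<in> carrier G} \<subseteq> {\<one>\<^bsub>G\<^esub>}"
    by blast
  then have "brace_star_set G M X (carrier G) \<subseteq> {\<one>\<^bsub>G\<^esub>}"
    unfolding brace_star_set_def
    by (intro additive.generate_subgroup_incl additive.triv_subgroup)
  moreover have "\<one>\<^bsub>G\<^esub> \<in> brace_star_set G M X (carrier G)"
    unfolding brace_star_set_def by (rule generate.one)
  ultimately show "brace_star_set G M X (carrier G) = {\<one>\<^bsub>G\<^esub>}" by blast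
qed

lemma right_series_trivial_mono:
  assumes "1 \<le> m" "m \<le> n" "right_series G M m = {\<one>\<^bsub>G\<^esub>}"
  shows "right_series G M n = {\<one>\<^bsub>G\<^esub>}"
  using assms(2)
proof (induction n rule: dec_induct)
  case base
  show ?case by (fact assms(3))
next
  case (step n)
  then obtain j where j: "n = Suc j" using assms(1) by (cases n) auto
  have "{\<one>\<^bsub>G\<^esub>} \<subseteq> gamma_kernel G M"
    using subgroup.one_closed[OF gamma_kernel_subgroup] by simp
  then show ?case using step.IH by (simp add: j star_set_carrier_trivial_iff)
qed

lemma right_nilpotency_class_le_iff:
  "right_nilpotent G M \<and> right_nilpotency_class G M \<le> c \<longleftrightarrow>
    right_series G M (Suc c) = {\<one>\<^bsub>G\<^esub>}"
proof
  let ?P = "\<lambda>m. m \<ge> 1 \<and> right_series G M m = {\<one>\<^bsub>G\<^esub>}"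
  assume *: "right_nilpotent G M \<and> right_nilpotency_class G M \<le> c"
  then have "?P (LEAST m. ?P m)"
    unfolding right_nilpotent_def by (metis (mono_tags, lifting) LeastI_ex)
  moreover have "(LEAST m. ?P m) \<le> Suc c"
    using * unfolding right_nilpotency_class_def by linarith
  ultimately show "right_series G M (Suc c) = {\<one>\<^bsub>G\<^esub>}"
    using right_series_trivial_mono by blast
next
  let ?P = "\<lambda>m. m \<ge> 1 \<and> right_series G M m = {\<one>\<^bsub>G\<^esub>}"
  assume "right_series G M (Suc c) = {\<one>\<^bsub>G\<^esub>}"
  then have P: "?P (Suc c)" by simp
  then have "(LEAST m. ?P m) \<le> Suc c" by (rule Least_le)
  then show "right_nilpotent G M \<and> right_nilpotency_class G M \<le> c"
    using P unfolding right_nilpotent_def right_nilpotency_class_def by auto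
qed

lemma star_subset_kernel_iff_right_nilpotent:
  "brace_star_set G M (carrier G) (carrier G) \<subseteq> gamma_kernel G M \<longleftrightarrow>
    right_nilpotent G M \<and> right_nilpotency_class G M \<le> 2"
proof -
  have "right_series G M (Suc 2)
      = brace_star_set G M (brace_star_set G M (carrier G) (carrier G)) (carrier G)"
    by (simp add: numeral_2_eq_2)
  then show ?thesis
    by (simp add: right_nilpotency_class_le_iff star_set_carrier_trivial_iff star_set_subset)
qed

end

theorem theorem3p13:
  fixes G :: "('a, 'b) monoid_scheme" and M :: "('a, 'c) monoid_scheme"
  assumes "skew_brace G M"
  shows "(gamma_homomorphic G M \<longleftrightarrow>
           brace_star_set G M (carrier G) (carrier G) \<subseteq> gamma_kernel G M)
       \<and> (brace_star_set G M (carrier G) (carrier G) \<subseteq> gamma_kernel G M \<longleftrightarrow>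
           right_nilpotent G M \<and> right_nilpotency_class G M \<le> 2)"
  using skew_brace.gamma_homomorphic_iff_star_subset_kernel[OF assms]
    skew_brace.star_subset_kernel_iff_right_nilpotent[OF assms]
  by blast

end
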